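(* Let $G=\bigoplus_{i\in I}A_i$ be a completely decomposable torsion-free abelian group, where each $A_i$ is a torsion-free group of rank $1$ and type $\tau_i$. Then the following conditions are equivalent: (a) $G$ is Bassian-finite. (b) $G$ satisfies the ascending type condition. (c) $G$ is relatively co-Hopfian.
   Context: All groups are abelian, written additively. A group is completely decomposable if it is a direct sum of torsion-free groups of rank $1$. The type of a rank-one torsion-free group is its isomorphism class, with the usual partial order: for rank-one torsion-free groups $A,A'$ of types $\tau,\tau'$, one has $\tau\leq\tau'$ if and only if there is a monomorphism $A\to A'$. A group $G$ is Bassian-finite if there is no monomorphism from $G$ to any proper direct summand of $G$ (a direct summand different from $G$). A group $G$ is relatively co-Hopfian if for every monomorphism $\phi:G\to G$, the subgroup $\phi(G)$ is essential in $G$, i.e. $\phi(G)\cap B\neq\{0\}$ for every non-zero subgroup $B\leq G$. The completely decomposable group $G=\bigoplus_{i\in I}A_i$ satisfies the ascending type condition if there is no infinite sequence of distinct indices $i_0,i_1,i_2,\dots\in I$ with $\tau_{i_0}\leq\tau_{i_1}\leq\tau_{i_2}\leq\cdots$. *)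

theory Defs
  imports "HOL-Algebra.Algebra"
begin

text \<open>
  HOL-Algebra groups are written multiplicatively: the additive \<open>0\<close>, \<open>n x\<close> and finite sums
  appear as \<open>\<one>\<close>, \<open>x [^] n\<close> and \<open>finprod\<close>. Monomorphisms are the elements of \<open>mon G H\<close>
  (injective homomorphisms), and the direct sum of a family is \<open>sum_group\<close>, the subgroup of
  finitely supported elements of the product.
\<close>

definition torsion_free :: "('a, 'b) monoid_scheme \<Rightarrow> bool"
  where "torsion_free G \<longleftrightarrow>
    (\<forall>x \<in> carrier G. \<forall>n::nat. 0 < n \<longrightarrow> x [^]\<^bsub>G\<^esub> n = \<one>\<^bsub>G\<^esub> \<longrightarrow> x = \<one>\<^bsub>G\<^esub>)"

definition int_independent :: "('a, 'b) monoid_scheme \<Rightarrow> 'a set \<Rightarrow> bool"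
  where "int_independent G S \<longleftrightarrow> S \<subseteq> carrier G \<and>
    (\<forall>F c. finite F \<longrightarrow> F \<subseteq> S \<longrightarrow>
       finprod G (\<lambda>x. x [^]\<^bsub>G\<^esub> (c x :: int)) F = \<one>\<^bsub>G\<^esub> \<longrightarrow> (\<forall>x \<in> F. c x = 0))"

definition maximal_int_independent :: "('a, 'b) monoid_scheme \<Rightarrow> 'a set \<Rightarrow> bool"
  where "maximal_int_independent G S \<longleftrightarrow> int_independent G S \<and>
    (\<forall>T. int_independent G T \<longrightarrow> S \<subseteq> T \<longrightarrow> T = S)"

definition has_rank :: "('a, 'b) monoid_scheme \<Rightarrow> nat \<Rightarrow> bool"
  where "has_rank G n \<longleftrightarrow> (\<exists>S. maximal_int_independent G S \<and> finite S \<and> card S = n)"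

definition rank_one_torsion_free :: "('a, 'b) monoid_scheme \<Rightarrow> bool"
  where "rank_one_torsion_free A \<longleftrightarrow> comm_group A \<and> torsion_free A \<and> has_rank A 1"

text \<open>
  The type of \<open>A\<close> is its isomorphism class, taken among the groups over the same HOL type. The
  condition \<open>comm_group B\<close> is needed because \<open>\<cong>\<close> does not force the record \<open>B\<close> to satisfy the
  group axioms.
\<close>

definition group_type :: "('a, 'b) monoid_scheme \<Rightarrow> ('a, 'b) monoid_scheme set"
  where "group_type A = {B. comm_group B \<and> B \<cong> A}"

definition type_le :: "('a, 'b) monoid_scheme set \<Rightarrow> ('a, 'b) monoid_scheme set \<Rightarrow> bool"
  where "type_le \<sigma> \<tau> \<longleftrightarrow> (\<exists>A \<in> \<sigma>. \<exists>B \<in> \<tau>. mon A B \<noteq> {})"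

lemma type_le_group_type_iff:
  fixes A B :: "('a, 'b) monoid_scheme"
  assumes "comm_group A" "comm_group B"
  shows "type_le (group_type A) (group_type B) \<longleftrightarrow> mon A B \<noteq> {}"
proof
  assume "type_le (group_type A) (group_type B)"
  then obtain A' B' :: "('a, 'b) monoid_scheme" and f where A': "comm_group A'" "A' \<cong> A" and B': "comm_group B'" "B' \<cong> B"
    and f: "f \<in> mon A' B'"
    by (auto simp: type_le_def group_type_def)
  have "group A'"
    using A'(1) by (simp add: comm_group.axioms)
  then have "A \<cong> A'"
    using A'(2) by (simp add: group.iso_sym)
  then obtain g where g: "g \<in> iso A A'"
    by (auto simp: is_iso_def)
  obtain h where h: "h \<in> iso B' B"
    using B'(2) by (auto simp: is_iso_def)
  have "h \<circ> f \<circ> g \<in> hom A B"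
    using f g h by (auto simp: mon_def iso_def intro: hom_compose)
  moreover have "inj_on (h \<circ> f \<circ> g) (carrier A)"
  proof -
    have "g ` carrier A = carrier A'" "inj_on g (carrier A)" "inj_on f (carrier A')"
      "f ` carrier A' \<subseteq> carrier B'" "inj_on h (carrier B')"
      using f g h by (auto simp: mon_def iso_def bij_betw_def hom_def)
    then show ?thesis
      by (metis comp_inj_on inj_on_subset image_comp)
  qed
  ultimately show "mon A B \<noteq> {}"
    by (auto simp: mon_def)
next
  assume "mon A B \<noteq> {}"
  moreover have "A \<in> group_type A" "B \<in> group_type B"
    using assms iso_refl by (auto simp: group_type_def)
  ultimately show "type_le (group_type A) (group_type B)"
    by (auto simp: type_le_def)
qed

definition ascending_type_condition :: "'i set \<Rightarrow> ('i \<Rightarrow> ('a, 'b) monoid_scheme) \<Rightarrow> bool"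
  where "ascending_type_condition I A \<longleftrightarrow>
    \<not> (\<exists>s :: nat \<Rightarrow> 'i. inj s \<and> range s \<subseteq> I \<and>
         (\<forall>n. type_le (group_type (A (s n))) (group_type (A (s (Suc n))))))"

definition direct_summand :: "'a set \<Rightarrow> ('a, 'b) monoid_scheme \<Rightarrow> bool"
  where "direct_summand H G \<longleftrightarrow> subgroup H G \<and>
    (\<exists>K. subgroup K G \<and> H \<inter> K = {\<one>\<^bsub>G\<^esub>} \<and> H <#>\<^bsub>G\<^esub> K = carrier G)"

definition Bassian_finite :: "('a, 'b) monoid_scheme \<Rightarrow> bool"
  where "Bassian_finite G \<longleftrightarrow>
    \<not> (\<exists>H. direct_summand H G \<and> H \<noteq> carrier G \<and> mon G (G\<lparr>carrier := H\<rparr>) \<noteq> {})"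

definition essential_subgroup :: "'a set \<Rightarrow> ('a, 'b) monoid_scheme \<Rightarrow> bool"
  where "essential_subgroup H G \<longleftrightarrow> subgroup H G \<and>
    (\<forall>B. subgroup B G \<longrightarrow> B \<noteq> {\<one>\<^bsub>G\<^esub>} \<longrightarrow> H \<inter> B \<noteq> {\<one>\<^bsub>G\<^esub>})"

definition relatively_co_Hopfian :: "('a, 'b) monoid_scheme \<Rightarrow> bool"
  where "relatively_co_Hopfian G \<longleftrightarrow>
    (\<forall>\<phi> \<in> mon G G. essential_subgroup (\<phi> ` carrier G) G)"

end

theory Submission
  imports Defs
begin

text \<open>
  An injective endomorphism \<open>\<phi>\<close> of \<open>G\<close> gives a locally finite digraph on \<open>I\<close>, with an edge from
  \<open>i\<close> to \<open>j\<close> when \<open>\<phi>\<close> maps \<open>A i\<close> non-trivially, hence injectively, into the component \<open>A j\<close>.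
  Under the ascending type condition there is no infinite simple path, so by Koenig's lemma
  finitely many indices are reachable from the support of an element \<open>b \<noteq> 0\<close>. The orbit of \<open>b\<close>
  thus lies in a subgroup of finite rank, and a linear relation between \<open>b\<close>, \<open>\<phi> b\<close>, \<open>\<phi>\<^sup>2 b\<close>, \<dots>
  puts a non-zero multiple of \<open>b\<close> into the image of \<open>\<phi>\<close>. Conversely, an ascending sequence of
  types allows a shift of the corresponding summands, which embeds \<open>G\<close> into a proper summand.
\<close>

section \<open>Torsion-free groups and linear dependence in rank one\<close>

lemma (in group) int_pow_eq_one_torsion_free:
  assumes "torsion_free G" "x \<in> carrier G" "x [^] (n::int) = \<one>" "n \<noteq> 0"
  shows "x = \<one>"
proof -
  have "x [^] (nat \<bar>n\<bar>) = \<one>"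
  proof (cases "n < 0")
    case True
    then show ?thesis
      using assms(2,3) by (simp only: int_pow_def2 if_True abs_of_neg inv_eq_1_iff nat_pow_closed)
  next
    case False
    then show ?thesis
      using assms(3) by (simp add: int_pow_def2 del: pow_nat)
  qed
  moreover have "0 < nat \<bar>n\<bar>"
    using assms(4) by simp
  ultimately show ?thesis
    using assms(1,2) unfolding torsion_free_def by metis
qed

text \<open>The single element of a maximal independent set serves as \<open>a\<close>. By
  maximality every other \<open>x\<close> is dependent on it, and since \<open>a\<close> has
  infinite order, the coefficient of \<open>x\<close> in the relation cannot vanish.\<close>

lemma rank_one_torsion_free_ex_nontrivial:
  assumes "rank_one_torsion_free A"
  obtains a where "a \<in> carrier A" "a \<noteq> \<one>\<^bsub>A\<^esub>"
    "\<And>x. x \<in> carrier A \<Longrightarrow> \<exists>(p::int) (q::int). q \<noteq> 0 \<and> x [^]\<^bsub>A\<^esub> q = a [^]\<^bsub>A\<^esub> p"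
proof -
  from assms have "comm_group A" and "has_rank A 1"
    by (auto simp: rank_one_torsion_free_def)
  interpret comm_group A by fact
  obtain a where max: "maximal_int_independent A {a}"
    using \<open>has_rank A 1\<close> by (auto simp: has_rank_def card_1_singleton_iff)
  then have ind: "int_independent A {a}" and a: "a \<in> carrier A"
    by (auto simp: maximal_int_independent_def int_independent_def)
  have pow1: "c = 0" if "a [^]\<^bsub>A\<^esub> (c::int) = \<one>\<^bsub>A\<^esub>" for c
  proof -
    have "finprod A (\<lambda>x. x [^]\<^bsub>A\<^esub> (c::int)) {a} = \<one>\<^bsub>A\<^esub>"
      using a that by simp
    then show ?thesis
      using ind unfolding int_independent_def by (auto dest!: spec[where x="{a}"] spec[where x="\<lambda>_. c"])
  qed
  have "a \<noteq> \<one>\<^bsub>A\<^esub>"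
    using pow1[of 1] by auto
  moreover have "\<exists>(p::int) (q::int). q \<noteq> 0 \<and> x [^]\<^bsub>A\<^esub> q = a [^]\<^bsub>A\<^esub> p" if x: "x \<in> carrier A" for x
  proof (cases "x = a")
    case True
    then show ?thesis
      by (intro exI[of _ 1]) simp
  next
    case False
    then have "\<not> int_independent A {a, x}"
      using max unfolding maximal_int_independent_def by blast
    then obtain F and c :: "_ \<Rightarrow> int" where F: "F \<subseteq> {a, x}"
      and prod: "finprod A (\<lambda>y. y [^]\<^bsub>A\<^esub> c y) F = \<one>\<^bsub>A\<^esub>" and nz: "\<exists>y\<in>F. c y \<noteq> 0"
      using a x by (auto simp: int_independent_def)
    \<comment> \<open>Independence is tested on finite subsets, so the relation may involve only one
      of the two elements; \<open>nz\<close> excludes the empty set.\<close>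
    consider "F = {a}" | "F = {x}" | "F = {a, x}"
      using F nz by blast
    then show ?thesis
    proof cases
      case 1
      then show ?thesis
        using prod nz pow1 a by auto
    next
      case 2
      then show ?thesis
        using prod nz x by (intro exI[of _ 0] exI[of _ "c x"]) auto
    next
      case 3
      then have eq: "a [^]\<^bsub>A\<^esub> c a \<otimes>\<^bsub>A\<^esub> x [^]\<^bsub>A\<^esub> c x = \<one>\<^bsub>A\<^esub>"
        using prod a x False by simp
      \<comment> \<open>If \<open>c x\<close> were zero, \<open>eq\<close> would reduce to a power
        of \<open>a\<close>, and \<open>pow1\<close> would make \<open>c a\<close> vanish too,
        against \<open>nz\<close>.\<close>
      then have "c x \<noteq> 0"
        using pow1[of "c a"] nz 3 a by auto
      moreover have "x [^]\<^bsub>A\<^esub> c x = a [^]\<^bsub>A\<^esub> (- c a)"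
        using eq a x by (metis int_pow_closed int_pow_neg inv_equality inv_inv m_comm)
      ultimately show ?thesis
        by blast
    qed
  qed
  ultimately show ?thesis
    using that a by blast
qed

text \<open>Eliminates the reference element \<open>a\<close> between the relations of
  \<open>x\<close> and of \<open>y\<close> to it: both sides become \<open>a\<close> to the power
  \<open>p * p'\<close>. The new exponent of \<open>x\<close> is non-zero because \<open>y\<close>,
  being non-trivial, has no torsion.\<close>

lemma rank_one_torsion_free_dependent:
  assumes "rank_one_torsion_free A" "x \<in> carrier A" "y \<in> carrier A" "y \<noteq> \<one>\<^bsub>A\<^esub>"
  shows "\<exists>(p::int) (q::int). q \<noteq> 0 \<and> x [^]\<^bsub>A\<^esub> q = y [^]\<^bsub>A\<^esub> p"
proof -
  from assms(1) have "comm_group A" and tf: "torsion_free A"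
    by (auto simp: rank_one_torsion_free_def)
  interpret comm_group A by fact
  obtain a where a: "a \<in> carrier A"
    and dep: "\<And>x. x \<in> carrier A \<Longrightarrow> \<exists>(p::int) (q::int). q \<noteq> 0 \<and> x [^]\<^bsub>A\<^esub> q = a [^]\<^bsub>A\<^esub> p"
    using rank_one_torsion_free_ex_nontrivial[OF assms(1)] by metis
  obtain p q p' q' :: int where q: "q \<noteq> 0" "x [^]\<^bsub>A\<^esub> q = a [^]\<^bsub>A\<^esub> p"
    and q': "q' \<noteq> 0" "y [^]\<^bsub>A\<^esub> q' = a [^]\<^bsub>A\<^esub> p'"
    using dep assms(2,3) by meson
  have "p' \<noteq> 0"
    using q' int_pow_eq_one_torsion_free[OF tf assms(3)] assms(4) by (metis int_pow_0)
  moreover have "x [^]\<^bsub>A\<^esub> (q * p') = y [^]\<^bsub>A\<^esub> (q' * p)"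
    using q(2) q'(2) a assms(2,3) by (metis int_pow_pow mult.commute)
  ultimately show ?thesis
    using q(1) by (intro exI[of _ "q' * p"] exI[of _ "q * p'"]) simp
qed

section \<open>Infinite simple paths in locally finite digraphs\<close>

text \<open>In Koenig's argument the set \<open>V\<close> of vertices already visited makes the path simple.\<close>

lemma locally_finite_simple_path:
  fixes E :: "'i \<Rightarrow> 'i set"
  assumes fin: "\<And>i. finite (E i)" and inf: "infinite ({(i, j). j \<in> E i}\<^sup>* `` {r})"
  obtains s :: "nat \<Rightarrow> 'i" where "inj s" "s 0 = r" "\<And>n. s (Suc n) \<in> E (s n)"
proof -
  define R where "R V = {(i, j). j \<in> E i \<and> j \<notin> V}" for V
  \<comment> \<open>The state of the construction: the current vertex is new, and infinitely many
    vertices can be reached from it without entering the visited set \<open>V\<close>.\<close>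
  define P where "P = (\<lambda>(i, V). i \<notin> V \<and> infinite ((R V)\<^sup>* `` {i}))"
  have step: "\<exists>j \<in> E i. P (j, insert i V)" if "P (i, V)" for i V
  proof -
    \<comment> \<open>After its last visit to \<open>i\<close>, a path leads through some successor
      \<open>j\<close> and avoids \<open>i\<close> from there on. As \<open>i\<close> has finitely
      many successors, one of them inherits an infinite reachable set.\<close>
    have "(R V)\<^sup>* `` {i} \<subseteq> insert i (\<Union>j \<in> E i - insert i V. (R (insert i V))\<^sup>* `` {j})"
    proof
      fix k
      assume "k \<in> (R V)\<^sup>* `` {i}"
      then have "(i, k) \<in> (R V)\<^sup>*"
        by simp
      then show "k \<in> insert i (\<Union>j \<in> E i - insert i V. (R (insert i V))\<^sup>* `` {j})"
      proof (induction rule: rtrancl_induct)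
        case base
        show ?case by simp
      next
        case (step k l)
        show ?case
        proof (cases "l = i \<or> k = i")
          case True
          with step.hyps show ?thesis
            by (auto simp: R_def)
        next
          case False
          then obtain j where j: "j \<in> E i - insert i V" "(j, k) \<in> (R (insert i V))\<^sup>*"
            using step.IH by auto
          have "(k, l) \<in> R (insert i V)"
            using step.hyps False by (auto simp: R_def)
          with j show ?thesis
            by (auto intro: rtrancl_into_rtrancl)
        qed
      qed
    qed
    moreover have "infinite ((R V)\<^sup>* `` {i})"
      using that by (simp add: P_def)
    ultimately have "infinite (\<Union>j \<in> E i - insert i V. (R (insert i V))\<^sup>* `` {j})"
      by (meson finite_insert finite_subset)
    then obtain j where "j \<in> E i - insert i V" "infinite ((R (insert i V))\<^sup>* `` {j})"
      using fin by (meson finite_Diff finite_UN_I)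
    then show ?thesis
      by (auto simp: P_def)
  qed
  have "P (r, {})"
    using inf by (simp add: P_def R_def)
  then have "\<exists>f. \<forall>n. (P (f n) \<and> (n = 0 \<longrightarrow> f n = (r, {}))) \<and>
    (fst (f (Suc n)) \<in> E (fst (f n)) \<and> snd (f (Suc n)) = insert (fst (f n)) (snd (f n)))"
    by (intro dependent_nat_choice) (use step in fastforce)+
  then obtain f where P: "\<And>n. P (f n)" and f0: "f 0 = (r, {})"
    and E: "\<And>n. fst (f (Suc n)) \<in> E (fst (f n))"
    and ins: "\<And>n. snd (f (Suc n)) = insert (fst (f n)) (snd (f n))"
    by blast
  have visited: "fst (f m) \<in> snd (f n)" if "m < n" for m n
    using that by (induction n) (auto simp: ins less_Suc_eq)
  have fresh: "fst (f n) \<notin> snd (f n)" for n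
    using P[of n] by (auto simp: P_def case_prod_unfold)
  \<comment> \<open>Every earlier vertex lies in the visited set of a later state, whereas the
    current vertex does not.\<close>
  have "inj (\<lambda>n. fst (f n))"
    by (rule linorder_injI) (use visited fresh in metis)
  then show ?thesis
    using that[of "\<lambda>n. fst (f n)"] f0 E by simp
qed

section \<open>Elimination in a group with finitely many rank-one coordinates\<close>

text \<open>Gaussian elimination: for each \<open>j\<close> the last \<open>x k\<close> with non-trivial \<open>j\<close>-coordinate serves as
  pivot, so that the relation found expresses a power of \<open>x k\<close> by later elements only.\<close>

lemma (in comm_group) finite_rank_dependent:
  fixes x :: "nat \<Rightarrow> 'a" and f :: "'i \<Rightarrow> 'a \<Rightarrow> 'c" and A :: "'i \<Rightarrow> ('c, 'd) monoid_scheme"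
  assumes "finite J" "finite K" "card J < card K"
    and A: "\<And>j. j \<in> J \<Longrightarrow> rank_one_torsion_free (A j)"
    and f: "\<And>j. j \<in> J \<Longrightarrow> f j \<in> hom G (A j)"
    and x: "\<And>k. k \<in> K \<Longrightarrow> x k \<in> carrier G"
    and H: "\<And>k. subgroup (H k) G"
    and xH: "\<And>k l. k \<in> K \<Longrightarrow> l \<in> K \<Longrightarrow> k < l \<Longrightarrow> x l \<in> H k"
  obtains k y and q :: int where "k \<in> K" "q \<noteq> 0" "y \<in> H k"
    "\<And>j. j \<in> J \<Longrightarrow> f j (x k [^] q) = f j y"
proof -
  have "\<exists>k\<in>K. \<exists>(q::int) y. q \<noteq> 0 \<and> y \<in> H k \<and> (\<forall>j\<in>J. f j (x k [^] q) = f j y)"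
    using assms
  \<comment> \<open>\<open>H\<close> is generalised because the induction hypothesis is applied to
    \<open>H k\<close> intersected with the kernel of \<open>f j\<close>. This puts \<open>y\<close>
    into that kernel, so the \<open>j\<close>-coordinates agree as well.\<close>
  proof (induction J arbitrary: K x H rule: finite_induct)
    case empty
    then obtain k where "k \<in> K"
      by fastforce
    then show ?case
      using subgroup.one_closed[OF empty(6)] by (intro bexI[of _ k] exI[of _ 1] exI[of _ "\<one>"]) auto
  next
    case (insert j J)
    let ?Ker = "kernel G (A j) (f j)"
    have Aj: "rank_one_torsion_free (A j)" and fj: "f j \<in> hom G (A j)"
      using insert.prems by simp_all
    interpret Aj: comm_group "A j"
      using Aj by (simp add: rank_one_torsion_free_def)
    interpret fj: group_hom G "A j" "f j"
      by unfold_locales (use fj in simp)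
    have HK: "subgroup (H k \<inter> ?Ker) G" for k
      using insert.prems(6) fj.subgroup_kernel by (rule subgroups_Inter_pair)
    define N where "N = {k \<in> K. x k \<notin> ?Ker}"
    show ?case
    proof (cases "N = {}")
      case True
      have "\<exists>k\<in>K. \<exists>(q::int) y. q \<noteq> 0 \<and> y \<in> H k \<inter> ?Ker \<and> (\<forall>i\<in>J. f i (x k [^] q) = f i y)"
      proof (rule insert.IH)
        show "card J < card K"
          using insert.prems(2) insert.hyps by simp
        show "x l \<in> H k \<inter> ?Ker" if "k \<in> K" "l \<in> K" "k < l" for k l
          using that insert.prems(7)[of k l] True by (auto simp: N_def)
      qed (use insert.prems HK in auto)
      then obtain k y and q :: int where k: "k \<in> K" "q \<noteq> 0" "y \<in> H k" "y \<in> ?Ker"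
        and eq: "\<forall>i\<in>J. f i (x k [^] q) = f i y"
        by blast
      have "x k \<in> ?Ker"
        using k(1) True by (auto simp: N_def)
      then have "f j (x k [^] q) = f j y"
        using k(4) by (simp add: kernel_def fj.hom_int_pow)
      with k eq show ?thesis
        by blast
    next
      case False
      define m where "m = Max N"
      have "finite N"
        using insert.prems(1) by (simp add: N_def)
      then have "m \<in> N" and max: "\<And>k. k \<in> N \<Longrightarrow> k \<le> m"
        using False by (auto simp: m_def)
      then have m: "m \<in> K" "x m \<in> carrier G" "f j (x m) \<noteq> \<one>\<^bsub>A j\<^esub>"
        using insert.prems(5)[of m] by (auto simp: N_def kernel_def)
      have "\<exists>(p::int) (q::int). q \<noteq> 0 \<and> f j (x k) [^]\<^bsub>A j\<^esub> q = f j (x m) [^]\<^bsub>A j\<^esub> p" if "k \<in> K" for k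
        by (rule rank_one_torsion_free_dependent[OF Aj]) (use that m insert.prems(5) in simp_all)
      then obtain p q :: "nat \<Rightarrow> int" where q: "\<And>k. k \<in> K \<Longrightarrow> q k \<noteq> 0"
        and pq: "\<And>k. k \<in> K \<Longrightarrow> f j (x k) [^]\<^bsub>A j\<^esub> q k = f j (x m) [^]\<^bsub>A j\<^esub> p k"
        by metis
      \<comment> \<open>For \<open>k < m\<close> the pivot cancels the \<open>j\<close>-coordinate
        of a power of \<open>x k\<close>; for \<open>k > m\<close> this coordinate is trivial
        already by the choice of \<open>m\<close>.\<close>
      define x' where "x' k = (if k < m then x k [^] q k \<otimes> inv (x m [^] p k) else x k)" for k
      have x': "x' k \<in> carrier G" if "k \<in> K" for k
        using that m(2) insert.prems(5) by (simp add: x'_def)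
      have ker: "x' k \<in> ?Ker" if "k \<in> K - {m}" for k
      proof (cases "k < m")
        case True
        then show ?thesis
          using that m(2) insert.prems(5) pq
          by (simp add: x'_def kernel_def fj.hom_int_pow fj.hom_inv)
      next
        case False
        then have "k \<notin> N"
          using max[of k] that by auto
        then show ?thesis
          using False that by (simp add: x'_def N_def)
      qed
      have "\<exists>k\<in>K - {m}. \<exists>(q::int) y. q \<noteq> 0 \<and> y \<in> H k \<inter> ?Ker \<and> (\<forall>i\<in>J. f i (x' k [^] q) = f i y)"
      proof (rule insert.IH)
        show "card J < card (K - {m})"
          using insert.prems(1,2) insert.hyps m(1) by simp
        fix k l
        assume kl: "k \<in> K - {m}" "l \<in> K - {m}" "k < l"
        \<comment> \<open>If \<open>l < m\<close>, then \<open>k < l < m\<close>, so both factors of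
          \<open>x' l\<close> come from indices above \<open>k\<close> and lie in
          \<open>H k\<close>.\<close>
        have "x' l \<in> H k"
        proof (cases "l < m")
          case True
          interpret Hk: subgroup "H k" G
            by (rule insert.prems(6))
          have "x l \<in> H k" "x m \<in> H k"
            using insert.prems(7) kl m(1) True by auto
          then show ?thesis
            using True by (simp add: x'_def subgroup_int_pow_closed[OF insert.prems(6)])
        next
          case False
          then show ?thesis
            using insert.prems(7) kl by (simp add: x'_def)
        qed
        then show "x' l \<in> H k \<inter> ?Ker"
          using ker kl by blast
      qed (use insert.prems HK x' in auto)
      then obtain k y and r :: int where k: "k \<in> K" "k \<noteq> m" "r \<noteq> 0" "y \<in> H k" "y \<in> ?Ker"
        and eq: "\<forall>i\<in>J. f i (x' k [^] r) = f i y"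
        by blast
      have "f j (x' k [^] r) = f j y"
        using ker[of k] k by (simp add: kernel_def fj.hom_int_pow)
      with eq have eq': "f i (x' k [^] r) = f i y" if "i \<in> insert j J" for i
        using that by blast
      show ?thesis
      proof (cases "k < m")
        case False
        then show ?thesis
          using k eq' by (auto simp: x'_def)
      next
        case True
        \<comment> \<open>Undoes the substitution: \<open>x k\<close> to the power
          \<open>q k * r\<close> is \<open>x' k\<close> to the power \<open>r\<close> times
          \<open>x m\<close> to the power \<open>p k * r\<close>. The second factor lies in
          \<open>H k\<close> because \<open>k < m\<close>.\<close>
        define y' where "y' = y \<otimes> x m [^] (p k * r)"
        interpret Hk: subgroup "H k" G
          by (rule insert.prems(6))
        have xk: "x k \<in> carrier G"
          using k insert.prems(5) by simp
        have "x m \<in> H k"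
          using True insert.prems(7) k(1) m(1) by simp
        then have "y' \<in> H k"
          using k(4) by (simp add: y'_def subgroup_int_pow_closed[OF insert.prems(6)])
        moreover have "f i (x k [^] (q k * r)) = f i y'" if i: "i \<in> insert j J" for i
        proof -
          interpret Ai: comm_group "A i"
            using insert.prems(3)[OF i] by (simp add: rank_one_torsion_free_def)
          interpret fi: group_hom G "A i" "f i"
            by unfold_locales (use insert.prems(4)[OF i] in simp)
          have "x k [^] (q k * r) = x' k [^] r \<otimes> x m [^] (p k * r)"
            using True xk m(2)
            by (simp add: x'_def int_pow_distrib int_pow_inv int_pow_pow[symmetric] m_assoc)
          then show ?thesis
            using eq'[OF i] k(1,4) m(2) x' by (simp add: y'_def)
        qed
        ultimately show ?thesis
          using k(1,3) q[OF k(1)] by (intro bexI[of _ k] exI[of _ "q k * r"] exI[of _ y']) auto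
      qed
    qed
  qed
  then show ?thesis
    using that by blast
qed

section \<open>Homomorphisms out of rank-one groups\<close>

text \<open>A non-zero power of \<open>a\<close> is a power of any given non-trivial kernel element,
  so \<open>h a\<close> would be a torsion element of \<open>B\<close>.\<close>

lemma rank_one_torsion_free_hom_imp_mon:
  assumes "rank_one_torsion_free A" "comm_group B" "torsion_free B" "h \<in> hom A B"
    and a: "a \<in> carrier A" "h a \<noteq> \<one>\<^bsub>B\<^esub>"
  shows "h \<in> mon A B"
proof -
  interpret A: comm_group A
    using assms(1) by (simp add: rank_one_torsion_free_def)
  interpret B: comm_group B
    by fact
  interpret h: group_hom A B h
    by unfold_locales fact
  have "x = \<one>\<^bsub>A\<^esub>" if x: "x \<in> carrier A" "h x = \<one>\<^bsub>B\<^esub>" for x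
  proof (rule ccontr)
    assume "x \<noteq> \<one>\<^bsub>A\<^esub>"
    then obtain p q :: int where q: "q \<noteq> 0" "a [^]\<^bsub>A\<^esub> q = x [^]\<^bsub>A\<^esub> p"
      using rank_one_torsion_free_dependent[OF assms(1) a(1) x(1)] by blast
    have "h a [^]\<^bsub>B\<^esub> q = h x [^]\<^bsub>B\<^esub> p"
      using q(2) a(1) x(1) by (metis h.hom_int_pow)
    then have "h a [^]\<^bsub>B\<^esub> q = \<one>\<^bsub>B\<^esub>"
      by (simp add: x(2))
    then show False
      using B.int_pow_eq_one_torsion_free[OF assms(3) _ _ q(1)] a by auto
  qed
  then show ?thesis
    using assms(4) by (auto simp: mon_def h.inj_on_one_iff)
qed

section \<open>Direct sums of rank-one groups in coordinates\<close>

text \<open>Describes a direct sum by its coordinate maps: supports are finite, coordinates separate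
  elements, and every finitely supported family is realised. The arguments can thus take place in
  \<open>G\<close> itself instead of in \<open>sum_group\<close>.\<close>

locale rank_one_sum = comm_group G for G (structure) +
  fixes I :: "'i set" and A :: "'i \<Rightarrow> ('c, 'd) monoid_scheme" and \<pi> :: "'i \<Rightarrow> 'a \<Rightarrow> 'c"
  assumes rank_one: "\<And>i. i \<in> I \<Longrightarrow> rank_one_torsion_free (A i)"
    and proj_hom: "\<And>i. i \<in> I \<Longrightarrow> \<pi> i \<in> hom G (A i)"
    and finite_support: "\<And>g. g \<in> carrier G \<Longrightarrow> finite {i \<in> I. \<pi> i g \<noteq> \<one>\<^bsub>A i\<^esub>}"
    and proj_eqI: "\<And>g h. g \<in> carrier G \<Longrightarrow> h \<in> carrier G \<Longrightarrow> (\<And>i. i \<in> I \<Longrightarrow> \<pi> i g = \<pi> i h) \<Longrightarrow> g = h"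
    and proj_ex: "\<And>x. (\<And>i. i \<in> I \<Longrightarrow> x i \<in> carrier (A i)) \<Longrightarrow> finite {i \<in> I. x i \<noteq> \<one>\<^bsub>A i\<^esub>} \<Longrightarrow>
      \<exists>g \<in> carrier G. \<forall>i \<in> I. \<pi> i g = x i"
begin

lemma comm_group_A: "i \<in> I \<Longrightarrow> comm_group (A i)"
  using rank_one by (simp add: rank_one_torsion_free_def)

lemma torsion_free_A: "i \<in> I \<Longrightarrow> torsion_free (A i)"
  using rank_one by (simp add: rank_one_torsion_free_def)

lemma one_closed_A [simp]: "i \<in> I \<Longrightarrow> \<one>\<^bsub>A i\<^esub> \<in> carrier (A i)"
  using comm_group_A[of i] by (simp add: comm_group_def comm_monoid_def monoid.one_closed)

lemma group_hom_proj: "i \<in> I \<Longrightarrow> group_hom G (A i) (\<pi> i)"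
  using comm_group_A proj_hom by (simp add: group_hom_def group_hom_axioms_def comm_group_def)

definition supp :: "'a \<Rightarrow> 'i set"
  where "supp g = {i \<in> I. \<pi> i g \<noteq> \<one>\<^bsub>A i\<^esub>}"

lemma finite_supp: "g \<in> carrier G \<Longrightarrow> finite (supp g)"
  by (simp add: supp_def finite_support)

lemma supp_subset: "supp g \<subseteq> I"
  by (auto simp: supp_def)

text \<open>For \<open>i\<close> in \<open>I\<close> and \<open>a\<close> in \<open>A i\<close> the
  choice is unambiguous: \<open>proj_ex\<close> gives existence and \<open>proj_eqI\<close>
  uniqueness.\<close>

definition embed :: "'i \<Rightarrow> 'c \<Rightarrow> 'a"
  where "embed i a = (SOME g. g \<in> carrier G \<and> (\<forall>j \<in> I. \<pi> j g = (if j = i then a else \<one>\<^bsub>A j\<^esub>)))"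

lemma embed:
  assumes "i \<in> I" "a \<in> carrier (A i)"
  shows embed_closed: "embed i a \<in> carrier G"
    and proj_embed: "j \<in> I \<Longrightarrow> \<pi> j (embed i a) = (if j = i then a else \<one>\<^bsub>A j\<^esub>)"
proof -
  have "finite {j \<in> I. (if j = i then a else \<one>\<^bsub>A j\<^esub>) \<noteq> \<one>\<^bsub>A j\<^esub>}"
    by (rule finite_subset[of _ "{i}"]) auto
  then have "\<exists>g. g \<in> carrier G \<and> (\<forall>j \<in> I. \<pi> j g = (if j = i then a else \<one>\<^bsub>A j\<^esub>))"
    using proj_ex[of "\<lambda>j. if j = i then a else \<one>\<^bsub>A j\<^esub>"] assms
    by (simp add: Bex_def)
  then have "embed i a \<in> carrier G \<and> (\<forall>j \<in> I. \<pi> j (embed i a) = (if j = i then a else \<one>\<^bsub>A j\<^esub>))"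
    unfolding embed_def by (rule someI_ex)
  then show "embed i a \<in> carrier G" "j \<in> I \<Longrightarrow> \<pi> j (embed i a) = (if j = i then a else \<one>\<^bsub>A j\<^esub>)"
    by auto
qed

lemma embed_hom:
  assumes i: "i \<in> I"
  shows "embed i \<in> hom (A i) G"
proof -
  interpret Ai: comm_group "A i"
    using i by (rule comm_group_A)
  have "embed i (a \<otimes>\<^bsub>A i\<^esub> b) = embed i a \<otimes> embed i b"
    if ab: "a \<in> carrier (A i)" "b \<in> carrier (A i)" for a b
  proof (rule proj_eqI)
    fix j
    assume j: "j \<in> I"
    interpret \<pi>: group_hom G "A j" "\<pi> j"
      using j by (rule group_hom_proj)
    show "\<pi> j (embed i (a \<otimes>\<^bsub>A i\<^esub> b)) = \<pi> j (embed i a \<otimes> embed i b)"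
      using i j ab by (simp add: embed_closed proj_embed)
  qed (use i ab in \<open>simp_all add: embed_closed\<close>)
  then show ?thesis
    using i by (auto simp: hom_def embed_closed)
qed

lemma proj_one: "i \<in> I \<Longrightarrow> \<pi> i \<one> = \<one>\<^bsub>A i\<^esub>"
  by (rule group_hom.hom_one[OF group_hom_proj])

lemma supp_empty_imp_one:
  assumes "g \<in> carrier G" "supp g = {}"
  shows "g = \<one>"
  by (rule proj_eqI) (use assms in \<open>auto simp: supp_def proj_one\<close>)

lemma subgroup_supp:
  "subgroup {g \<in> carrier G. supp g \<subseteq> J} G"
proof (unfold_locales)
  show "\<one> \<in> {g \<in> carrier G. supp g \<subseteq> J}"
    by (auto simp: supp_def proj_one)
next
  fix g h
  assume gh: "g \<in> {g \<in> carrier G. supp g \<subseteq> J}" "h \<in> {g \<in> carrier G. supp g \<subseteq> J}"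
  have "\<pi> i (g \<otimes> h) = \<one>\<^bsub>A i\<^esub>" if "i \<in> I - J" for i
  proof -
    interpret \<pi>: group_hom G "A i" "\<pi> i"
      using that by (simp add: group_hom_proj)
    have "\<pi> i g = \<one>\<^bsub>A i\<^esub>" "\<pi> i h = \<one>\<^bsub>A i\<^esub>"
      using gh that by (auto simp: supp_def)
    then show ?thesis
      using gh by simp
  qed
  then show "g \<otimes> h \<in> {g \<in> carrier G. supp g \<subseteq> J}"
    using gh by (auto simp: supp_def)
next
  fix g
  assume g: "g \<in> {g \<in> carrier G. supp g \<subseteq> J}"
  have "\<pi> i (inv g) = \<one>\<^bsub>A i\<^esub>" if "i \<in> I - J" for i
  proof -
    interpret \<pi>: group_hom G "A i" "\<pi> i"
      using that by (simp add: group_hom_proj)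
    have "\<pi> i g = \<one>\<^bsub>A i\<^esub>"
      using g that by (auto simp: supp_def)
    then show ?thesis
      using g by simp
  qed
  then show "inv g \<in> {g \<in> carrier G. supp g \<subseteq> J}"
    using g by (auto simp: supp_def)
qed auto

text \<open>Reduces invariance to single components: induction on a finite set containing the
  support splits off one component \<open>embed i (\<pi> i g)\<close> at a time, and elements
  supported in \<open>J\<close> form a subgroup.\<close>

lemma supp_hom:
  assumes \<phi>: "\<phi> \<in> hom G G"
    and \<phi>_inv: "\<And>i a. i \<in> J \<Longrightarrow> i \<in> I \<Longrightarrow> a \<in> carrier (A i) \<Longrightarrow> supp (\<phi> (embed i a)) \<subseteq> J"
    and g: "g \<in> carrier G" "supp g \<subseteq> J"
  shows "supp (\<phi> g) \<subseteq> J"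
proof -
  interpret \<phi>: group_hom G G \<phi>
    by unfold_locales fact
  have "supp (\<phi> g) \<subseteq> J" if "finite F" "F \<subseteq> J \<inter> I" "g \<in> carrier G" "supp g \<subseteq> F" for F g
    using that
  proof (induction F arbitrary: g rule: finite_induct)
    case empty
    then have "g = \<one>"
      by (intro supp_empty_imp_one) auto
    then show ?case
      using subgroup.one_closed[OF subgroup_supp, of J] by simp
  next
    case (insert i F)
    then have i: "i \<in> I" "i \<in> J"
      by auto
    interpret \<pi>i: group_hom G "A i" "\<pi> i"
      using i(1) by (rule group_hom_proj)
    define e where "e = embed i (\<pi> i g)"
    have e: "e \<in> carrier G"
      using i insert.prems by (simp add: e_def embed_closed)
    have "supp (g \<otimes> inv e) \<subseteq> F"
    proof
      fix j
      assume j: "j \<in> supp (g \<otimes> inv e)"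
      then have "j \<in> I"
        by (simp add: supp_def)
      interpret \<pi>: group_hom G "A j" "\<pi> j"
        using \<open>j \<in> I\<close> by (rule group_hom_proj)
      interpret Aj: comm_group "A j"
        using \<open>j \<in> I\<close> by (rule comm_group_A)
      have eq: "\<pi> j (g \<otimes> inv e) = \<pi> j g \<otimes>\<^bsub>A j\<^esub> inv\<^bsub>A j\<^esub> (\<pi> j e)"
        using insert.prems e by simp
      have "\<pi> j e = (if j = i then \<pi> j g else \<one>\<^bsub>A j\<^esub>)"
        using i insert.prems \<open>j \<in> I\<close> by (simp add: e_def proj_embed)
      then have "j \<noteq> i \<and> \<pi> j g \<noteq> \<one>\<^bsub>A j\<^esub>"
        using j eq insert.prems by (auto simp: supp_def split: if_splits)
      then show "j \<in> F"
        using insert.prems \<open>j \<in> I\<close> by (auto simp: supp_def)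
    qed
    then have "supp (\<phi> (g \<otimes> inv e)) \<subseteq> J"
      using insert.prems e by (intro insert.IH) simp_all
    moreover have "supp (\<phi> e) \<subseteq> J"
      using \<phi>_inv i insert.prems by (simp add: e_def)
    ultimately have "\<phi> (g \<otimes> inv e) \<otimes> \<phi> e \<in> {g \<in> carrier G. supp g \<subseteq> J}"
      using e insert.prems by (intro subgroup.m_closed[OF subgroup_supp]) auto
    moreover have "\<phi> (g \<otimes> inv e) \<otimes> \<phi> e = \<phi> g"
      using e insert.prems by (simp add: m_assoc)
    ultimately show ?case
      by simp
  qed
  from this[of "supp g"] show ?thesis
    using g finite_supp supp_subset by blast
qed

lemma torsion_free: "torsion_free G"
  unfolding torsion_free_def
proof (intro ballI allI impI)
  fix x and n :: nat
  assume x: "x \<in> carrier G" and n: "0 < n" "x [^] n = \<one>"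
  show "x = \<one>"
  proof (rule proj_eqI)
    fix i
    assume i: "i \<in> I"
    interpret \<pi>: group_hom G "A i" "\<pi> i"
      using i by (rule group_hom_proj)
    have "\<pi> i x [^]\<^bsub>A i\<^esub> n = \<one>\<^bsub>A i\<^esub>"
      using n(2) x \<pi>.hom_nat_pow[of x n] by simp
    then show "\<pi> i x = \<pi> i \<one>"
      using torsion_free_A[OF i] n(1) x unfolding torsion_free_def by simp
  qed (use x in auto)
qed

section \<open>Iterates of an injective endomorphism\<close>

lemma funpow_hom: "\<phi> \<in> hom G G \<Longrightarrow> \<phi> ^^ n \<in> hom G G"
proof (induction n)
  case (Suc n)
  then show ?case
    using Group.hom_compose[of "\<phi> ^^ n" G G \<phi> G] by (simp add: comp_def)
qed (simp add: hom_def)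

text \<open>The orbit of \<open>b\<close> lies in a subgroup of finite rank, so \<open>\<phi> ^^ k\<close> maps some power of \<open>b\<close> into
  \<open>(\<phi> ^^ Suc k) ` G\<close>, and \<open>\<phi> ^^ k\<close> can be cancelled.\<close>

lemma power_in_image:
  assumes mon: "\<phi> \<in> mon G G" and "finite J"
    and \<phi>_inv: "\<And>g. g \<in> carrier G \<Longrightarrow> supp g \<subseteq> J \<Longrightarrow> supp (\<phi> g) \<subseteq> J"
    and b: "b \<in> carrier G" "supp b \<subseteq> J"
  obtains q :: int where "q \<noteq> 0" "b [^] q \<in> \<phi> ` carrier G"
proof -
  have \<phi>: "\<phi> \<in> hom G G" and inj: "inj_on \<phi> (carrier G)"
    using mon by (auto simp: mon_def)
  let ?GJ = "{g \<in> carrier G. supp g \<subseteq> J}"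
  define H where "H k = (\<phi> ^^ Suc k) ` ?GJ" for k
  have pow: "group_hom G G (\<phi> ^^ k)" for k
    using funpow_hom[OF \<phi>] by unfold_locales
  have GJ: "(\<phi> ^^ k) g \<in> ?GJ" if "g \<in> ?GJ" for g k
    using that \<phi> \<phi>_inv by (induction k) (auto simp: hom_def)
  have inj_pow: "inj_on (\<phi> ^^ k) (carrier G)" for k
  proof (induction k)
    case (Suc k)
    show ?case
    proof (rule inj_onI)
      fix x y
      assume xy: "x \<in> carrier G" "y \<in> carrier G" "(\<phi> ^^ Suc k) x = (\<phi> ^^ Suc k) y"
      then have "(\<phi> ^^ k) x = (\<phi> ^^ k) y"
        using inj funpow_hom[OF \<phi>, of k] by (auto simp: hom_def inj_on_def)
      then show "x = y"
        using Suc xy by (auto simp: inj_on_def)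
    qed
  qed simp
  \<comment> \<open>The orbit segment has one element more than there are coordinates, since
    \<open>{..n}\<close> has \<open>n + 1\<close> elements.\<close>
  have fin: "finite (J \<inter> I)" "finite {..card (J \<inter> I)}" "card (J \<inter> I) < card {..card (J \<inter> I)}"
    using \<open>finite J\<close> by auto
  have subH: "subgroup (H k) G" for k
    unfolding H_def by (rule group_hom.subgroup_img_is_subgroup[OF pow subgroup_supp])
  have mem: "(\<phi> ^^ l) b \<in> H k" if "k < l" for k l
  proof -
    have "(\<phi> ^^ l) b = (\<phi> ^^ Suc k) ((\<phi> ^^ (l - Suc k)) b)"
      using that by (metis Suc_leI comp_apply funpow_add le_add_diff_inverse)
    then show ?thesis
      using GJ[of b "l - Suc k"] b by (auto simp: H_def simp del: funpow.simps)
  qed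
  obtain k y and q :: int where q: "q \<noteq> 0" "y \<in> H k"
    and eq: "\<And>j. j \<in> J \<inter> I \<Longrightarrow> \<pi> j ((\<phi> ^^ k) b [^] q) = \<pi> j y"
  proof (rule finite_rank_dependent[OF fin, where A = A and f = \<pi> and x = "\<lambda>k. (\<phi> ^^ k) b" and H = H])
    show "(\<phi> ^^ k) b \<in> carrier G" for k
      using GJ[of b k] b by simp
  qed (use rank_one proj_hom subH mem in auto)
  obtain z where z: "z \<in> ?GJ" "y = (\<phi> ^^ Suc k) z"
    using q(2) by (auto simp: H_def)
  \<comment> \<open>Agreement on the coordinates in \<open>J\<close> suffices, because both sides
    are supported in \<open>J\<close>.\<close>
  have "(\<phi> ^^ k) b [^] q = y"
  proof (rule proj_eqI)
    fix i
    assume i: "i \<in> I"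
    show "\<pi> i ((\<phi> ^^ k) b [^] q) = \<pi> i y"
    proof (cases "i \<in> J")
      case True
      then show ?thesis
        using eq i by simp
    next
      case False
      have "y \<in> ?GJ" "(\<phi> ^^ k) b [^] q \<in> ?GJ"
        using GJ[OF z(1), of "Suc k"] z(2) GJ[of b k] b
          subgroup_int_pow_closed[OF subgroup_supp] by auto
      then have "i \<notin> supp y" "i \<notin> supp ((\<phi> ^^ k) b [^] q)"
        using False by blast+
      then show ?thesis
        using i by (simp add: supp_def)
    qed
  next
    show "(\<phi> ^^ k) b [^] q \<in> carrier G"
      using GJ[of b k] b by simp
    show "y \<in> carrier G"
      using GJ[OF z(1), of "Suc k"] z(2) by simp
  qed
  then have "(\<phi> ^^ k) (b [^] q) = (\<phi> ^^ k) (\<phi> z)"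
    using z(2) b group_hom.hom_int_pow[OF pow, of b k q] by (simp add: funpow_swap1)
  then have "b [^] q = \<phi> z"
    using inj_onD[OF inj_pow[of k]] b z(1) GJ[of z 1] by simp
  then show ?thesis
    using that q(1) z(1) by blast
qed

section \<open>The ascending type condition implies relative co-Hopficity\<close>

lemma relatively_co_Hopfian_if_ascending_type_condition:
  assumes "ascending_type_condition I A"
  shows "relatively_co_Hopfian G"
  unfolding relatively_co_Hopfian_def
proof
  fix \<phi>
  assume mon: "\<phi> \<in> mon G G"
  then have \<phi>: "\<phi> \<in> hom G G"
    by (simp add: mon_def)
  interpret \<phi>: group_hom G G \<phi>
    by unfold_locales fact
  have "\<exists>a. a \<in> carrier (A i) \<and> a \<noteq> \<one>\<^bsub>A i\<^esub>" if "i \<in> I" for i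
    using rank_one_torsion_free_ex_nontrivial[OF rank_one[OF that]] by metis
  then obtain a where a: "\<And>i. i \<in> I \<Longrightarrow> a i \<in> carrier (A i)" "\<And>i. i \<in> I \<Longrightarrow> a i \<noteq> \<one>\<^bsub>A i\<^esub>"
    by metis
  \<comment> \<open>The edges do not depend on the choice of \<open>a i\<close>: a homomorphism from
    a rank-one group to a torsion-free group is zero or injective. Outside \<open>I\<close> the
    value is empty, so that local finiteness holds at every point of the type.\<close>
  define E where "E i = (if i \<in> I then supp (\<phi> (embed i (a i))) else {})" for i
  have finE: "finite (E i)" for i
    using a by (simp add: E_def finite_supp embed_closed)
  have hom: "\<pi> j \<circ> \<phi> \<circ> embed i \<in> hom (A i) (A j)" if "i \<in> I" "j \<in> I" for i j
    by (rule Group.hom_compose[OF embed_hom[OF that(1)] Group.hom_compose[OF \<phi> proj_hom[OF that(2)]]])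
  have supp_E: "supp (\<phi> (embed i x)) \<subseteq> E i" if i: "i \<in> I" and x: "x \<in> carrier (A i)" for i x
  proof
    fix j
    assume "j \<in> supp (\<phi> (embed i x))"
    then have j: "j \<in> I" "\<pi> j (\<phi> (embed i x)) \<noteq> \<one>\<^bsub>A j\<^esub>"
      by (auto simp: supp_def)
    \<comment> \<open>One element \<open>x\<close> with a non-trivial \<open>j\<close>-coordinate
      makes the whole composite injective, hence non-trivial at \<open>a i\<close> too.\<close>
    then have "\<pi> j \<circ> \<phi> \<circ> embed i \<in> mon (A i) (A j)"
      using i x by (intro rank_one_torsion_free_hom_imp_mon[where a = x] rank_one comm_group_A
          torsion_free_A hom) auto
    moreover have "group (A i)" "group (A j)"
      using comm_group_A i j(1) by (auto simp: comm_group_def)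
    ultimately have "\<pi> j (\<phi> (embed i (a i))) \<noteq> \<one>\<^bsub>A j\<^esub>"
      using a[OF i] by (auto simp: mon_iff_hom_one)
    then show "j \<in> E i"
      using i j(1) by (simp add: E_def supp_def)
  qed
  have mon_E: "mon (A i) (A j) \<noteq> {}" if "j \<in> E i" for i j
  proof -
    have ij: "i \<in> I" "j \<in> I" "\<pi> j (\<phi> (embed i (a i))) \<noteq> \<one>\<^bsub>A j\<^esub>"
      using that by (auto simp: E_def supp_def split: if_splits)
    then have "\<pi> j \<circ> \<phi> \<circ> embed i \<in> mon (A i) (A j)"
      using a by (intro rank_one_torsion_free_hom_imp_mon[where a = "a i"] rank_one comm_group_A
          torsion_free_A hom) auto
    then show ?thesis
      by blast
  qed
  have reach: "finite ({(i, j). j \<in> E i}\<^sup>* `` {r})" if r: "r \<in> I" for r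
  proof (rule ccontr)
    assume "infinite ({(i, j). j \<in> E i}\<^sup>* `` {r})"
    then obtain s where s: "inj s" "s 0 = r" "\<And>n. s (Suc n) \<in> E (s n)"
      using locally_finite_simple_path[of E] finE by metis
    have sI: "s n \<in> I" for n
      using s(2) s(3)[of "n - 1"] r by (cases n) (auto simp: E_def supp_def split: if_splits)
    have "type_le (group_type (A (s n))) (group_type (A (s (Suc n))))" for n
      using mon_E[OF s(3)[of n]] sI comm_group_A by (simp add: type_le_group_type_iff)
    then show False
      using assms s(1) sI unfolding ascending_type_condition_def by blast
  qed
  show "essential_subgroup (\<phi> ` carrier G) G"
    unfolding essential_subgroup_def
  proof (intro conjI allI impI)
    show "subgroup (\<phi> ` carrier G) G"
      by (rule \<phi>.img_is_subgroup)
    fix B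
    assume B: "subgroup B G" "B \<noteq> {\<one>}"
    then obtain b where b: "b \<in> B" "b \<noteq> \<one>" "b \<in> carrier G"
      using subgroup.one_closed subgroup.mem_carrier by fastforce
    \<comment> \<open>Everything reachable from the support of \<open>b\<close>. It is closed under
      edges, hence invariant under \<phi>, and it is finite as a finite union of finite reachable
      sets.\<close>
    define J where "J = {(i, j). j \<in> E i}\<^sup>* `` supp b"
    have "J = (\<Union>r \<in> supp b. {(i, j). j \<in> E i}\<^sup>* `` {r})"
      by (auto simp: J_def)
    then have "finite J"
      using reach finite_supp[OF b(3)] supp_subset by auto
    moreover have "supp (\<phi> (embed i x)) \<subseteq> J" if "i \<in> J" "i \<in> I" "x \<in> carrier (A i)" for i x
    proof -
      have "E i \<subseteq> J"
        using that(1) by (auto simp: J_def intro: rtrancl_into_rtrancl)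
      then show ?thesis
        using supp_E that by blast
    qed
    then have "supp (\<phi> g) \<subseteq> J" if "g \<in> carrier G" "supp g \<subseteq> J" for g
      using supp_hom[OF \<phi>] that by blast
    moreover have "supp b \<subseteq> J"
      by (auto simp: J_def)
    ultimately obtain q :: int where q: "q \<noteq> 0" "b [^] q \<in> \<phi> ` carrier G"
      using power_in_image[OF mon] b(3) by metis
    have "b [^] q \<noteq> \<one>"
      using int_pow_eq_one_torsion_free[OF torsion_free b(3) _ q(1)] b(2) by blast
    moreover have "b [^] q \<in> B"
      using B(1) b(1) by (rule subgroup_int_pow_closed)
    ultimately show "\<phi> ` carrier G \<inter> B \<noteq> {\<one>}"
      using q(2) by blast
  qed
qed

section \<open>An ascending sequence of types embeds the group into a proper summand\<close>

lemma ascending_type_condition_if_Bassian_finite: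
  assumes "Bassian_finite G"
  shows "ascending_type_condition I A"
proof (rule ccontr)
  assume "\<not> ascending_type_condition I A"
  then obtain s :: "nat \<Rightarrow> 'i" where s: "inj s" "\<And>n. s n \<in> I"
    and le: "\<And>n. type_le (group_type (A (s n))) (group_type (A (s (Suc n))))"
    unfolding ascending_type_condition_def by blast
  have "mon (A (s n)) (A (s (Suc n))) \<noteq> {}" for n
    using le[of n] s(2) comm_group_A by (simp add: type_le_group_type_iff)
  then obtain f where f: "\<And>n. f n \<in> mon (A (s n)) (A (s (Suc n)))"
    unfolding ex_in_conv[symmetric] by metis
  interpret f: group_hom "A (s n)" "A (s (Suc n))" "f n" for n
    using f[of n] s(2) comm_group_A by (auto simp: group_hom_def group_hom_axioms_def comm_group_def mon_def)
  \<comment> \<open>These are the coordinates of the intended image of \<open>g\<close>: position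
    \<open>s 0\<close> is vacated, \<open>s (Suc n)\<close> receives the old coordinate at
    \<open>s n\<close> through \<open>f n\<close>, and indices off the sequence stay fixed.\<close>
  define shift where "shift g i =
    (if i \<in> range s then case the_inv s i of 0 \<Rightarrow> \<one>\<^bsub>A i\<^esub> | Suc n \<Rightarrow> f n (\<pi> (s n) g) else \<pi> i g)" for g i
  have shift_0: "shift g (s 0) = \<one>\<^bsub>A (s 0)\<^esub>" for g
    using s(1) by (simp add: shift_def the_inv_f_f)
  have shift_Suc: "shift g (s (Suc n)) = f n (\<pi> (s n) g)" for g n
    using s(1) by (simp add: shift_def the_inv_f_f)
  have shift_other: "shift g i = \<pi> i g" if "i \<notin> range s" for g i
    using that by (simp add: shift_def)
  have cases_I: thesis if "i = s 0 \<Longrightarrow> thesis" "\<And>n. i = s (Suc n) \<Longrightarrow> thesis" "i \<notin> range s \<Longrightarrow> thesis" for i thesis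
    using that by (metis rangeE not0_implies_Suc)
  have proj_closed: "\<pi> i g \<in> carrier (A i)" if "i \<in> I" "g \<in> carrier G" for i g
    using proj_hom that by (auto simp: hom_def)
  have shift_closed: "shift g i \<in> carrier (A i)" if "g \<in> carrier G" "i \<in> I" for g i
    by (rule cases_I[of i]) (use that s(2) proj_closed in \<open>auto simp: shift_0 shift_Suc shift_other\<close>)
  have "finite {i \<in> I. shift g i \<noteq> \<one>\<^bsub>A i\<^esub>}" if g: "g \<in> carrier G" for g
  proof (rule finite_subset)
    \<comment> \<open>A non-trivial coordinate at \<open>s (Suc n)\<close> forces \<open>s n\<close>
      into the support of \<open>g\<close>. Here \<open>the_inv s\<close> recovers \<open>n\<close>;
      members of the support outside \<open>range s\<close> merely enlarge the bound.\<close>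
    show "{i \<in> I. shift g i \<noteq> \<one>\<^bsub>A i\<^esub>} \<subseteq> supp g \<union> (\<lambda>i. s (Suc (the_inv s i))) ` supp g"
    proof
      fix i
      assume i: "i \<in> {i \<in> I. shift g i \<noteq> \<one>\<^bsub>A i\<^esub>}"
      show "i \<in> supp g \<union> (\<lambda>i. s (Suc (the_inv s i))) ` supp g"
      proof (rule cases_I[of i])
        fix n
        assume n: "i = s (Suc n)"
        then have "s n \<in> supp g"
          using i s(2) by (auto simp: shift_Suc supp_def)
        then have "s (Suc (the_inv s (s n))) \<in> (\<lambda>i. s (Suc (the_inv s i))) ` supp g"
          by blast
        then show ?thesis
          using n s(1) by (simp add: the_inv_f_f)
      qed (use i in \<open>auto simp: shift_0 shift_other supp_def\<close>)
    qed
  qed (use finite_supp[OF g] in simp)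
  then have "\<exists>h \<in> carrier G. \<forall>i \<in> I. \<pi> i h = shift g i" if "g \<in> carrier G" for g
    using that shift_closed by (intro proj_ex) auto
  then obtain \<phi> where \<phi>: "\<And>g. g \<in> carrier G \<Longrightarrow> \<phi> g \<in> carrier G"
    "\<And>g i. g \<in> carrier G \<Longrightarrow> i \<in> I \<Longrightarrow> \<pi> i (\<phi> g) = shift g i"
    by metis
  have hom: "\<phi> (g \<otimes> h) = \<phi> g \<otimes> \<phi> h" if gh: "g \<in> carrier G" "h \<in> carrier G" for g h
  proof (rule proj_eqI)
    fix i
    assume i: "i \<in> I"
    interpret Ai: comm_group "A i"
      using i by (rule comm_group_A)
    have mult: "\<pi> j (g \<otimes> h) = \<pi> j g \<otimes>\<^bsub>A j\<^esub> \<pi> j h" if "j \<in> I" for j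
      using proj_hom[OF that] gh by (simp add: hom_mult)
    have "shift (g \<otimes> h) i = shift g i \<otimes>\<^bsub>A i\<^esub> shift h i"
      by (rule cases_I[of i]) (use gh i s(2) in \<open>auto simp: shift_0 shift_Suc shift_other proj_closed mult\<close>)
    then show "\<pi> i (\<phi> (g \<otimes> h)) = \<pi> i (\<phi> g \<otimes> \<phi> h)"
      using gh i \<phi> proj_hom[OF i] by (simp add: hom_mult)
  qed (use gh \<phi> in auto)
  have inj: "inj_on \<phi> (carrier G)"
  proof (rule inj_onI, rule proj_eqI)
    fix g h i
    assume gh: "g \<in> carrier G" "h \<in> carrier G" "\<phi> g = \<phi> h" and i: "i \<in> I"
    have eq: "shift g j = shift h j" if "j \<in> I" for j
      using gh \<phi>(2) that by metis
    show "\<pi> i g = \<pi> i h"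
    proof (cases "i \<in> range s")
      case True
      then obtain n where n: "i = s n"
        by blast
      \<comment> \<open>The coordinate at \<open>s n\<close> is read off one place further along,
        where \<open>f n\<close> can be cancelled.\<close>
      have "f n (\<pi> (s n) g) = f n (\<pi> (s n) h)"
        using eq[of "s (Suc n)"] s(2) by (simp add: shift_Suc)
      then show ?thesis
        using f[of n] gh i n proj_closed by (auto simp: mon_def inj_on_def)
    next
      case False
      then show ?thesis
        using eq[OF i] by (simp add: shift_other)
    qed
  qed
  \<comment> \<open>\<open>K\<close> is the copy of \<open>A (s 0)\<close> in \<open>G\<close> and
    \<open>H\<close> the sum of all other components, which contains the shifted image.\<close>
  define H where "H = {g \<in> carrier G. supp g \<subseteq> - {s 0}}"
  define K where "K = {g \<in> carrier G. supp g \<subseteq> {s 0}}"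
  have \<phi>_H: "\<phi> g \<in> H" if "g \<in> carrier G" for g
    using \<phi> that s(2) by (auto simp: H_def supp_def shift_0)
  then have "\<phi> \<in> mon G (G\<lparr>carrier := H\<rparr>)"
    using hom inj by (auto simp: mon_def hom_def)
  moreover have "H \<noteq> carrier G"
  proof -
    obtain a where a: "a \<in> carrier (A (s 0))" "a \<noteq> \<one>\<^bsub>A (s 0)\<^esub>"
      using rank_one_torsion_free_ex_nontrivial[OF rank_one[OF s(2)]] by metis
    then have "embed (s 0) a \<in> carrier G" "s 0 \<in> supp (embed (s 0) a)"
      using s(2) by (auto simp: embed_closed proj_embed supp_def)
    then show ?thesis
      by (auto simp: H_def)
  qed
  moreover have "direct_summand H G"
  proof -
    have sub: "subgroup H G" "subgroup K G"
      by (simp_all only: H_def K_def subgroup_supp)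
    have "g = \<one>" if "g \<in> H \<inter> K" for g
      by (rule supp_empty_imp_one) (use that in \<open>auto simp: H_def K_def\<close>)
    then have "H \<inter> K = {\<one>}"
      using sub subgroup.one_closed by blast
    moreover have "g \<in> H <#> K" if g: "g \<in> carrier G" for g
    proof -
      \<comment> \<open>Splits \<open>g\<close> into its \<open>s 0\<close>-component and a
        remainder in \<open>H\<close>.\<close>
      define e where "e = embed (s 0) (\<pi> (s 0) g)"
      have e: "e \<in> carrier G"
        using g s(2) proj_closed by (simp add: e_def embed_closed)
      have proj_e: "\<pi> i e = (if i = s 0 then \<pi> i g else \<one>\<^bsub>A i\<^esub>)" if "i \<in> I" for i
        using g s(2) proj_closed that by (simp add: e_def proj_embed)
      interpret \<pi>: group_hom G "A (s 0)" "\<pi> (s 0)"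
        using s(2) by (rule group_hom_proj)
      have "\<pi> (s 0) (g \<otimes> inv e) = \<one>\<^bsub>A (s 0)\<^esub>"
        using g e s(2) by (simp add: proj_e)
      then have "g \<otimes> inv e \<in> H"
        using g e by (auto simp: H_def supp_def)
      moreover have "e \<in> K"
        using e by (auto simp: K_def supp_def proj_e split: if_splits)
      moreover have "g = g \<otimes> inv e \<otimes> e"
        using g e by (simp add: m_assoc)
      ultimately show ?thesis
        unfolding set_mult_def by blast
    qed
    then have "H <#> K = carrier G"
      using sub by (auto simp: set_mult_def subgroup.mem_carrier)
    ultimately show ?thesis
      using sub unfolding direct_summand_def by blast
  qed
  ultimately show False
    using assms unfolding Bassian_finite_def by blast
qed

end

section \<open>The remaining implication and the equivalence\<close>

text \<open>If \<phi> embedded \<open>G\<close> into a proper summand \<open>H\<close>, a complement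
  \<open>K\<close> would be a non-zero subgroup meeting the image only in the identity, so the image
  would not be essential.\<close>

lemma (in group) Bassian_finite_if_relatively_co_Hopfian:
  assumes "relatively_co_Hopfian G"
  shows "Bassian_finite G"
  unfolding Bassian_finite_def
proof
  assume "\<exists>H. direct_summand H G \<and> H \<noteq> carrier G \<and> mon G (G\<lparr>carrier := H\<rparr>) \<noteq> {}"
  then obtain H K \<phi> where H: "subgroup H G" "H \<noteq> carrier G" and K: "subgroup K G" "H \<inter> K = {\<one>}"
    and HK: "H <#> K = carrier G" and \<phi>: "\<phi> \<in> mon G (G\<lparr>carrier := H\<rparr>)"
    unfolding direct_summand_def by blast
  have "\<phi> \<in> mon G G" and img: "\<phi> ` carrier G \<subseteq> H"
    using \<phi> subgroup.subset[OF H(1)] by (auto simp: mon_def hom_def)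
  then have ess: "essential_subgroup (\<phi> ` carrier G) G"
    using assms by (simp add: relatively_co_Hopfian_def)
  have "K \<noteq> {\<one>}"
    using HK H subgroup.mem_carrier[OF H(1)] by (auto simp: set_mult_def)
  then have "\<phi> ` carrier G \<inter> K \<noteq> {\<one>}"
    using ess K(1) by (simp add: essential_subgroup_def)
  moreover have "\<one> \<in> \<phi> ` carrier G \<inter> K"
    using ess K(1) by (simp add: essential_subgroup_def subgroup.one_closed)
  ultimately show False
    using img K(2) by blast
qed

theorem proposition2p5:
  fixes G :: "('g, 'c) monoid_scheme"
    and I :: "'i set"
    and A :: "'i \<Rightarrow> ('a, 'b) monoid_scheme"
  assumes "comm_group G"
    and "\<And>i. i \<in> I \<Longrightarrow> rank_one_torsion_free (A i)"
    and "G \<cong> sum_group I A"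
  shows "(Bassian_finite G \<longleftrightarrow> ascending_type_condition I A) \<and>
         (ascending_type_condition I A \<longleftrightarrow> relatively_co_Hopfian G)"
proof -
  interpret comm_group G
    by fact
  have grp: "group (A i)" if "i \<in> I" for i
    using assms(2)[OF that] by (simp add: rank_one_torsion_free_def comm_group_def)
  note carrier = carrier_sum_group[of I A, OF grp]
  obtain \<theta> where "\<theta> \<in> iso G (sum_group I A)"
    using assms(3) by (auto simp: is_iso_def)
  then have hom: "\<theta> \<in> hom G (sum_group I A)" and bij: "bij_betw \<theta> (carrier G) (carrier (sum_group I A))"
    by (auto simp: iso_def)
  have \<theta>: "\<theta> g \<in> carrier (sum_group I A)" if "g \<in> carrier G" for g
    using hom that by (auto simp: hom_def)
  \<comment> \<open>The coordinates of \<open>sum_group\<close> are pulled back to \<open>G\<close>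
    along the isomorphism \<theta>.\<close>
  interpret rank_one_sum G I A "\<lambda>i g. \<theta> g i"
  proof
    fix i
    assume i: "i \<in> I"
    show "(\<lambda>g. \<theta> g i) \<in> hom G (A i)"
      using hom \<theta> i by (auto simp: hom_def carrier PiE_iff)
  next
    fix g
    assume "g \<in> carrier G"
    then show "finite {i \<in> I. \<theta> g i \<noteq> \<one>\<^bsub>A i\<^esub>}"
      using \<theta>[of g] by (simp add: carrier)
  next
    fix g h
    assume gh: "g \<in> carrier G" "h \<in> carrier G" "\<And>i. i \<in> I \<Longrightarrow> \<theta> g i = \<theta> h i"
    then have "\<theta> g = \<theta> h"
      using \<theta>[of g] \<theta>[of h] by (intro PiE_ext[of _ I "\<lambda>i. carrier (A i)"]) (auto simp: carrier)
    then show "g = h"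
      using bij gh by (auto simp: bij_betw_def inj_on_def)
  next
    fix x
    assume x: "\<And>i. i \<in> I \<Longrightarrow> x i \<in> carrier (A i)" "finite {i \<in> I. x i \<noteq> \<one>\<^bsub>A i\<^esub>}"
    \<comment> \<open>Elements of \<open>sum_group\<close> are extensional functions, hence the
      restriction to \<open>I\<close>.\<close>
    then have "restrict x I \<in> carrier (sum_group I A)"
      by (simp add: carrier cong: conj_cong)
    then obtain g where "g \<in> carrier G" "\<theta> g = restrict x I"
      using bij by (metis bij_betw_def imageE)
    then show "\<exists>g \<in> carrier G. \<forall>i \<in> I. \<theta> g i = x i"
      by (intro bexI[of _ g]) simp_all
  qed (use assms(2) in auto)
  \<comment> \<open>The implications close the cycle from (b) to (c) to (a) and back to (b).\<close>
  show ?thesis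
    using relatively_co_Hopfian_if_ascending_type_condition ascending_type_condition_if_Bassian_finite
      Bassian_finite_if_relatively_co_Hopfian by blast
qed

end
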